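(* Let $\alpha := \limsup_{N \to +\infty} \frac{\log(\#\mathfrak{E}_N)}{N}$. Then $\alpha < 0.421$; that is, $\log(\#\mathfrak{E}_N) < 0.421\, N$ for all sufficiently large integers $N$.
   Context: For each integer $N \geq 1$, $\mathfrak{E}_N := \left\{\sum_{n=1}^N \frac{t_n}{n} : t_1,\dots,t_N \in \{0,1\}\right\}$, a finite set of rational numbers, and $\#\mathfrak{E}_N$ is its cardinality (number of distinct values). *)

theory Defs
  imports Complex_Main "HOL-Library.Extended_Real" "HOL-Library.Liminf_Limsup"
begin

definition egyptian_sums :: "nat \<Rightarrow> rat set" where
  "egyptian_sums N = {(\<Sum>n=1..N. t n / of_nat n) | t. \<forall>n\<in>{1..N}. t n \<in> {0, 1}}"

(* The limit superior is taken in the extended reals, where it always exists.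
   The value of the sequence at N = 0 does not affect it. *)
definition egyptian_alpha :: ereal where
  "egyptian_alpha = limsup (\<lambda>N. ereal (ln (real (card (egyptian_sums N))) / real N))"

end

theory Submission
  imports Defs "HOL-Computational_Algebra.Primes" "HOL-Real_Asymp.Real_Asymp"
begin

text \<open>
  Fix an integer \<open>k\<close> and split the denominators \<open>n \<le> N\<close> into rough ones, which have a prime factor
  above \<open>N / k\<close>, and smooth ones. A prime above \<open>N / k\<close> has fewer than \<open>k\<close> multiples up to \<open>N\<close>, so
  there are at most \<open>k * \<pi>(N) = o(N)\<close> rough denominators, contributing \<open>exp (o(N))\<close> subset sums.
  The smooth unit fractions have a common denominator \<open>L\<close> whose logarithm is at most
  \<open>\<theta>(N / k) + o(N)\<close>, and their sums are at most \<open>N\<close>, so they contribute at most \<open>L * N + 1\<close> values.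
  Since \<open>\<theta>(y) \<le> y * ln 4\<close>, already \<open>k = 8\<close> gives a constant below \<open>0.421\<close>
  (and \<open>k \<longrightarrow> \<infinity>\<close> would give \<open>0\<close>).
\<close>

section \<open>Chebyshev's upper bound for the product of primes\<close>

lemma prod_primes_dvd:
  fixes n :: nat
  assumes "finite A" "\<And>p. p \<in> A \<Longrightarrow> prime p" "\<And>p. p \<in> A \<Longrightarrow> p dvd n"
  shows "\<Prod>A dvd n"
  using assms
proof (induction A rule: finite_induct)
  case (insert p A)
  have "coprime p (\<Prod>A)"
    using insert by (intro prod_coprime_right) (auto intro!: primes_coprime)
  then show ?case
    using insert by (simp add: divides_mult)
qed simp

text \<open>The two middle entries of row \<open>2 * m + 1\<close> are equal and together at most
  the row sum \<open>2 * 4 ^ m\<close>.\<close>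

lemma middle_binomial_le: "(2 * m + 1) choose m \<le> 4 ^ m"
proof -
  have "((2 * m + 1) choose m) + ((2 * m + 1) choose (m + 1)) = (\<Sum>k\<in>{m, m + 1}. (2 * m + 1) choose k)"
    by simp
  also have "\<dots> \<le> (\<Sum>k\<le>2 * m + 1. (2 * m + 1) choose k)"
    by (intro sum_mono2) auto
  also have "\<dots> = 2 * 4 ^ m"
    by (subst choose_row_sum) (simp add: power_mult)
  finally show ?thesis
    using binomial_symmetric[of m "2 * m + 1"] by simp
qed

text \<open>Erdos's argument by strong induction. An even \<open>n > 2\<close> is not prime, so it
  reduces to \<open>n - 1\<close>. For \<open>n = 2 * m + 1\<close> the primes in
  \<open>(m + 1, n]\<close> all divide \<open>n choose m\<close>, which costs \<open>4 ^ m\<close>,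
  and the primes up to \<open>m + 1\<close> cost \<open>4 ^ (m + 1)\<close> by induction.\<close>

lemma primorial_le: "\<Prod>{p::nat. prime p \<and> p \<le> n} \<le> 4 ^ n"
proof (induction n rule: less_induct)
  case (less n)
  consider "n \<le> 1" | "n = 2" | "n > 2" "even n" | m where "m \<ge> 1" "n = 2 * m + 1"
  proof (cases "even n")
    case False
    then obtain m where "n = 2 * m + 1" by (rule oddE)
    then show ?thesis using that(1) that(4)[of m] by (cases "m = 0") auto
  next
    case True
    then show ?thesis using that(1-3) by linarith
  qed
  then show ?case
  proof cases
    case 1
    then have none: "{p::nat. prime p \<and> p \<le> n} = {}"
      by (auto dest: prime_ge_2_nat)
    show ?thesis unfolding none by simp
  next
    case 2
    have two: "{p::nat. prime p \<and> p \<le> 2} = {2}"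
      by (auto dest: prime_ge_2_nat)
    show ?thesis unfolding 2 two by simp
  next
    case 3
    then have "\<not> prime n"
      using prime_odd_nat by blast
    then have "p \<le> n \<longleftrightarrow> p \<le> n - 1" if "prime p" for p
      using that 3 by (cases "p = n") auto
    then have "{p::nat. prime p \<and> p \<le> n} = {p. prime p \<and> p \<le> n - 1}"
      by blast
    then have "\<Prod>{p::nat. prime p \<and> p \<le> n} \<le> 4 ^ (n - 1)"
      using less.IH[of "n - 1"] 3 by simp
    also have "\<dots> \<le> 4 ^ n" by (rule power_increasing) auto
    finally show ?thesis .
  next
    case 4
    define A where "A = {p::nat. prime p \<and> m + 1 < p \<and> p \<le> n}"
    have fin: "finite A" unfolding A_def by (rule finite_subset[of _ "{..n}"]) auto
    have "\<Prod>A dvd n choose m"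
    proof (rule prod_primes_dvd[OF fin])
      fix p assume p: "p \<in> A"
      \<comment> \<open>This product is \<open>fact n\<close>, which \<open>p \<le> n\<close>
        divides; since \<open>p\<close> exceeds both \<open>m\<close> and
        \<open>n - m = m + 1\<close>, it must divide the binomial factor.\<close>
      then have "p dvd fact m * fact (n - m) * (n choose m)"
        using 4 by (subst binomial_fact_lemma) (auto simp: A_def prime_dvd_fact_iff simp del: fact_Suc)
      moreover have "\<not> p dvd fact m" "\<not> p dvd fact (n - m)"
        using p 4 by (auto simp: A_def prime_dvd_fact_iff simp del: fact_Suc)
      ultimately show "p dvd n choose m"
        using p by (auto simp: A_def prime_dvd_mult_iff)
    qed (simp add: A_def)
    then have "\<Prod>A \<le> n choose m"
      using 4 by (intro dvd_imp_le) auto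
    also have "\<dots> \<le> 4 ^ m" using middle_binomial_le 4 by blast
    finally have A: "\<Prod>A \<le> 4 ^ m" .
    have "{p::nat. prime p \<and> p \<le> n} = A \<union> {p. prime p \<and> p \<le> m + 1}"
      using 4 by (auto simp: A_def)
    then have "\<Prod>{p::nat. prime p \<and> p \<le> n} = \<Prod>A * \<Prod>{p. prime p \<and> p \<le> m + 1}"
      using fin by (simp only:) (rule prod.union_disjoint, auto simp: A_def)
    also have "\<dots> \<le> 4 ^ m * 4 ^ (m + 1)"
      using A less.IH[of "m + 1"] 4 by (intro mult_mono) auto
    also have "\<dots> = 4 ^ n"
      using 4 by (simp flip: power_add)
    finally show ?thesis .
  qed
qed

section \<open>Counting primes\<close>

lemma card_squares_le: "real (card {p::nat. p > 0 \<and> p\<^sup>2 \<le> n}) \<le> sqrt n"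
proof -
  have "{p::nat. p > 0 \<and> p\<^sup>2 \<le> n} \<subseteq> {1..nat \<lfloor>sqrt n\<rfloor>}"
  proof safe
    fix p :: nat assume "p > 0" "p\<^sup>2 \<le> n"
    then have "(real p)\<^sup>2 \<le> real n" by (metis of_nat_le_iff of_nat_power)
    then have "real p \<le> sqrt n" by (rule real_le_rsqrt)
    then show "p \<in> {1..nat \<lfloor>sqrt n\<rfloor>}" using \<open>p > 0\<close> by (auto simp: le_nat_floor)
  qed
  then have "card {p::nat. p > 0 \<and> p\<^sup>2 \<le> n} \<le> nat \<lfloor>sqrt n\<rfloor>"
    by (metis card_atLeastAtMost card_mono diff_Suc_1 finite_atLeastAtMost)
  then show ?thesis
    by (simp add: le_nat_iff le_floor_iff)
qed

text \<open>Primes up to \<open>sqrt N\<close> are counted trivially. Each larger prime has square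
  above \<open>N\<close>, so \<open>N\<close> to the number of them is at most the squared
  primorial, hence at most \<open>4 ^ (2 * N)\<close>; taking logarithms gives the second
  term.\<close>

lemma card_primes_le:
  assumes "N \<ge> 2"
  shows "real (card {p::nat. prime p \<and> p \<le> N}) \<le> sqrt N + 2 * ln 4 * N / ln N"
proof -
  define S where "S = {p::nat. p > 0 \<and> p\<^sup>2 \<le> N}"
  define T where "T = {p::nat. prime p \<and> p \<le> N \<and> p\<^sup>2 > N}"
  have finS: "finite S"
    unfolding S_def by (rule finite_subset[of _ "{..N}"]) (auto simp: power2_eq_square intro: order_trans[rotated])
  have finT: "finite T" unfolding T_def by (rule finite_subset[of _ "{..N}"]) auto
  have "{p::nat. prime p \<and> p \<le> N} \<subseteq> S \<union> T"
    by (auto simp: S_def T_def prime_gt_0_nat)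
  then have "card {p::nat. prime p \<and> p \<le> N} \<le> card S + card T"
    using finS finT by (meson card_Un_le card_mono finite_UnI order_trans)
  moreover have "real (card S) \<le> sqrt N"
    unfolding S_def by (rule card_squares_le)
  moreover have "real (card T) \<le> 2 * ln 4 * N / ln N"
  proof -
    have "N ^ card T = (\<Prod>p\<in>T. N)" by simp
    also have "\<dots> \<le> (\<Prod>p\<in>T. p\<^sup>2)"
      by (rule prod_mono) (auto simp: T_def)
    also have "\<dots> = (\<Prod>T)\<^sup>2" by (simp add: prod_power_distrib)
    also have "\<Prod>T \<le> \<Prod>{p::nat. prime p \<and> p \<le> N}"
      by (intro dvd_imp_le prod_dvd_prod_subset prod_pos)
         (auto simp: T_def prime_gt_0_nat intro: finite_subset[of _ "{..N}"])
    also have "\<dots> \<le> 4 ^ N" by (rule primorial_le)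
    finally have "N ^ card T \<le> (4 ^ N)\<^sup>2" by (simp add: power_mono)
    then have "real N ^ card T \<le> (4 ^ N)\<^sup>2"
      by (metis of_nat_le_iff of_nat_numeral of_nat_power)
    then have "ln (real N ^ card T) \<le> ln ((4 ^ N)\<^sup>2)"
      using assms by (subst ln_le_cancel_iff) auto
    then have "card T * ln N \<le> 2 * ln 4 * N"
      using assms by (simp add: ln_realpow mult_ac)
    then show ?thesis using assms by (simp add: field_simps)
  qed
  ultimately show ?thesis by linarith
qed

section \<open>The common denominator of the smooth unit fractions\<close>

text \<open>For \<open>N \<ge> 1\<close> this is the least common multiple of the
  \<open>y\<close>-smooth numbers up to \<open>N\<close>. The explicit factorization makes its size
  easy to estimate.\<close>

definition smooth_multiple :: "nat \<Rightarrow> nat \<Rightarrow> nat" where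
  "smooth_multiple y N = (\<Prod>p | prime p \<and> p \<le> y. p ^ (GREATEST e. p ^ e \<le> N))"

text \<open>The maximum exists because \<open>e < 2 ^ e \<le> p ^ e\<close> bounds every admissible
  exponent by \<open>N\<close>, and \<open>e = 0\<close> is admissible.\<close>

lemma Greatest_power_le:
  fixes p :: nat
  assumes "p \<ge> 2" "N \<ge> 1"
  shows "p ^ (GREATEST e. p ^ e \<le> N) \<le> N" and "p ^ e \<le> N \<Longrightarrow> e \<le> (GREATEST e. p ^ e \<le> N)"
proof -
  have bound: "e \<le> N" if "p ^ e \<le> N" for e
  proof -
    have "e < 2 ^ e" by (rule less_exp)
    also have "\<dots> \<le> p ^ e" using assms by (intro power_mono) auto
    finally show ?thesis using that by simp
  qed
  show "p ^ (GREATEST e. p ^ e \<le> N) \<le> N"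
    using assms bound by (intro GreatestI_nat[where P = "\<lambda>e. p ^ e \<le> N" and k = 0 and b = N]) auto
  show "p ^ e \<le> N \<Longrightarrow> e \<le> (GREATEST e. p ^ e \<le> N)"
    using bound by (intro Greatest_le_nat[where b = N]) auto
qed

lemma finite_primes_le: "finite {p::nat. prime p \<and> p \<le> y}"
  by (rule finite_subset[of _ "{..y}"]) auto

lemma smooth_dvd_smooth_multiple:
  assumes "1 \<le> n" "n \<le> N" "\<And>p. prime p \<Longrightarrow> p dvd n \<Longrightarrow> p \<le> y"
  shows "n dvd smooth_multiple y N"
proof -
  have "n = (\<Prod>p\<in>prime_factors n. p ^ multiplicity p n)"
    using assms by (intro prime_factorization_nat) auto
  also have "\<dots> dvd smooth_multiple y N"
    unfolding smooth_multiple_def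
  proof (rule prod_dvd_prod_subset2)
    show "prime_factors n \<subseteq> {p. prime p \<and> p \<le> y}"
      using assms by auto
    fix p assume p: "p \<in> prime_factors n"
    have "p ^ multiplicity p n \<le> n"
      using assms by (intro dvd_imp_le multiplicity_dvd) auto
    with assms p show "p ^ multiplicity p n dvd p ^ (GREATEST e. p ^ e \<le> N)"
      by (intro le_imp_power_dvd Greatest_power_le) (auto intro: prime_ge_2_nat)
  qed (rule finite_primes_le)
  finally show ?thesis .
qed

lemma smooth_multiple_pos: "smooth_multiple y N > 0"
  unfolding smooth_multiple_def by (rule prod_pos) (auto simp: prime_gt_0_nat)

text \<open>A prime with \<open>p\<^sup>2 > N\<close> occurs with exponent at most 1, so these
  primes are covered by the primorial of \<open>y\<close>. There are at most \<open>sqrt N\<close>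
  other primes, and each contributes a power of size at most \<open>N\<close>.\<close>

lemma ln_smooth_multiple_le:
  fixes y N :: nat
  assumes "N \<ge> 1"
  shows "ln (smooth_multiple y N) \<le> y * ln 4 + sqrt N * ln N"
proof -
  define S where "S = {p::nat. p > 0 \<and> p\<^sup>2 \<le> N}"
  let ?P = "{p::nat. prime p \<and> p \<le> y}"
  have finS: "finite S"
    unfolding S_def by (rule finite_subset[of _ "{..N}"]) (auto simp: power2_eq_square intro: order_trans[rotated])
  \<comment> \<open>For \<open>p\<close> in \<open>S\<close> the bound \<open>N\<close> would
    suffice; the spare factor \<open>p\<close> lets the full primorial split off.\<close>
  have "smooth_multiple y N \<le> (\<Prod>p\<in>?P. p * (if p \<in> S then N else 1))"
    unfolding smooth_multiple_def
  proof (rule prod_mono, rule conjI)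
    fix p assume "p \<in> ?P"
    then have p: "p \<ge> 2" by (auto intro: prime_ge_2_nat)
    let ?e = "GREATEST e. p ^ e \<le> N"
    note le = Greatest_power_le(1)[OF p assms]
    show "p ^ ?e \<le> p * (if p \<in> S then N else 1)"
    proof (cases "p \<in> S")
      case True
      have "p ^ ?e \<le> 1 * N" using le by simp
      also have "\<dots> \<le> p * N" using p by (intro mult_right_mono) auto
      finally show ?thesis using True by simp
    next
      case False
      then have "p ^ 2 > N" using p by (auto simp: S_def)
      then have "p ^ ?e < p ^ 2" using le by simp
      then have "?e < 2" using p by (metis power_less_imp_less_exp Suc_1 Suc_le_eq)
      then have "p ^ ?e \<le> p ^ 1" using p by (intro power_increasing) auto
      then show ?thesis using False by simp
    qed
  qed simp
  also have "\<dots> = \<Prod>?P * (\<Prod>p\<in>?P \<inter> S. N)"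
    by (simp add: prod.distrib prod.If_cases finite_primes_le)
  also have "\<dots> \<le> 4 ^ y * N ^ card S"
    using primorial_le[of y] assms finS
    by (intro mult_mono) (auto intro!: power_increasing card_mono)
  finally have "real (smooth_multiple y N) \<le> real (4 ^ y * N ^ card S)"
    by (simp only: of_nat_le_iff)
  then have "ln (smooth_multiple y N) \<le> ln (4 ^ y * real N ^ card S)"
    using smooth_multiple_pos assms by (subst ln_le_cancel_iff) auto
  also have "\<dots> = y * ln 4 + card S * ln N"
    using assms by (simp add: ln_mult ln_realpow)
  also have "real (card S) * ln N \<le> sqrt N * ln N"
    using card_squares_le assms unfolding S_def by (intro mult_right_mono) auto
  finally show ?thesis by simp
qed

section \<open>Counting rough denominators\<close>

definition rough_numbers :: "nat \<Rightarrow> nat \<Rightarrow> nat set" where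
  "rough_numbers y N = {n \<in> {1..N}. \<exists>p. prime p \<and> p > y \<and> p dvd n}"

lemma card_rough_numbers_le:
  assumes "k \<ge> 1"
  shows "card (rough_numbers (N div k) N) \<le> k * card {p::nat. prime p \<and> p \<le> N}"
proof -
  have "rough_numbers (N div k) N \<subseteq> (\<lambda>(p, m). p * m) ` ({p. prime p \<and> p \<le> N} \<times> {..<k})"
  proof
    fix n assume "n \<in> rough_numbers (N div k) N"
    then obtain p m where n: "1 \<le> n" "n \<le> N" "prime p" "p > N div k" "n = p * m"
      unfolding rough_numbers_def by (auto elim: dvdE)
    \<comment> \<open>The rounding in \<open>N div k\<close> loses nothing: for an integer
      \<open>p\<close>, exceeding it is the same as \<open>p * k > N\<close>. Hence the cofactor
      \<open>m\<close> is below \<open>k\<close>.\<close>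
    have "N < p * k"
      using n(4) assms by (simp add: div_less_iff_less_mult)
    with n have "m < k" by (metis mult_le_mono2 not_less order_trans)
    moreover have "p \<le> N"
      using n by (metis dvd_imp_le dvd_triv_left less_eq_Suc_le One_nat_def order_trans)
    ultimately show "n \<in> (\<lambda>(p, m). p * m) ` ({p. prime p \<and> p \<le> N} \<times> {..<k})"
      using n by auto
  qed
  then have "card (rough_numbers (N div k) N) \<le> card ({p::nat. prime p \<and> p \<le> N} \<times> {..<k})"
    by (intro surj_card_le finite_SigmaI finite_primes_le) auto
  then show ?thesis by (simp add: card_cartesian_product mult.commute)
qed

section \<open>Counting the subset sums\<close>

text \<open>A sum is encoded by the set of rough denominators it uses and by the numerator over
  \<open>L\<close> of its smooth part. At most \<open>N\<close> terms, each with numerator at most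
  \<open>L\<close>, keep that numerator within \<open>L * N\<close>.\<close>

lemma egyptian_sums_subset:
  fixes y N :: nat
  defines "L \<equiv> smooth_multiple y N"
  shows "egyptian_sums N \<subseteq>
    (\<lambda>(S, k). (\<Sum>n\<in>S. 1 / of_nat n) + of_nat k / of_nat L) ` (Pow (rough_numbers y N) \<times> {..L * N})"
proof
  fix x assume "x \<in> egyptian_sums N"
  then obtain t :: "nat \<Rightarrow> rat" where t: "x = (\<Sum>n=1..N. t n / of_nat n)" "\<forall>n\<in>{1..N}. t n \<in> {0, 1}"
    unfolding egyptian_sums_def by auto
  define B where "B = rough_numbers y N"
  define S where "S = {n \<in> B. t n = 1}"
  define T where "T = {n \<in> {1..N} - B. t n = 1}"
  have B: "B \<subseteq> {1..N}" by (auto simp: B_def rough_numbers_def)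
  have finB: "finite B" using B finite_subset by blast
  have L: "L > 0" by (simp add: L_def smooth_multiple_pos)
  have "x = (\<Sum>n\<in>B. t n / of_nat n) + (\<Sum>n\<in>{1..N} - B. t n / of_nat n)"
    unfolding t using B by (subst add.commute, intro sum.subset_diff) auto
  also have "(\<Sum>n\<in>B. t n / of_nat n) = (\<Sum>n\<in>S. 1 / of_nat n)"
    using t B finB by (intro sum.mono_neutral_cong_right) (auto simp: S_def)
  also have "(\<Sum>n\<in>{1..N} - B. t n / of_nat n) = (\<Sum>n\<in>T. 1 / of_nat n)"
    using t B by (intro sum.mono_neutral_cong_right) (auto simp: T_def)
  also have "\<dots> = (\<Sum>n\<in>T. of_nat (L div n) / of_nat L)"
  proof (rule sum.cong)
    fix n assume "n \<in> T"
    then have "n dvd L"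
      unfolding L_def by (intro smooth_dvd_smooth_multiple) (auto simp: T_def B_def rough_numbers_def not_less)
    then show "(1::rat) / of_nat n = of_nat (L div n) / of_nat L"
      using L by (auto elim!: dvdE)
  qed simp
  also have "\<dots> = of_nat (\<Sum>n\<in>T. L div n) / of_nat L"
    by (simp add: sum_divide_distrib)
  finally have x: "x = (\<Sum>n\<in>S. 1 / of_nat n) + of_nat (\<Sum>n\<in>T. L div n) / of_nat L" .
  have "(\<Sum>n\<in>T. L div n) \<le> (\<Sum>n\<in>T. L)" by (intro sum_mono) simp
  also have "\<dots> = card T * L" by simp
  also have "card T \<le> card {1..N}" by (rule card_mono) (auto simp: T_def)
  finally have "(\<Sum>n\<in>T. L div n) \<le> L * N" by (simp add: mult.commute)
  moreover have "S \<in> Pow (rough_numbers y N)" by (auto simp: S_def B_def)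
  ultimately show "x \<in> (\<lambda>(S, k). (\<Sum>n\<in>S. 1 / of_nat n) + of_nat k / of_nat L) `
      (Pow (rough_numbers y N) \<times> {..L * N})"
    using x by (intro image_eqI[of _ _ "(S, \<Sum>n\<in>T. L div n)"]) auto
qed

lemma finite_rough_numbers: "finite (rough_numbers y N)"
  by (simp add: rough_numbers_def)

lemma card_egyptian_sums_le:
  "card (egyptian_sums N) \<le> 2 ^ card (rough_numbers y N) * (smooth_multiple y N * N + 1)"
proof -
  have "card (egyptian_sums N) \<le> card (Pow (rough_numbers y N) \<times> {..smooth_multiple y N * N})"
    by (rule surj_card_le[OF _ egyptian_sums_subset]) (simp add: finite_rough_numbers)
  then show ?thesis by (simp add: card_cartesian_product card_Pow finite_rough_numbers)
qed

lemma card_egyptian_sums_pos: "card (egyptian_sums N) > 0"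
proof -
  have "finite (egyptian_sums N)"
    \<comment> \<open>The threshold 0 is arbitrary; every \<open>y\<close> gives a finite
      superset.\<close>
    by (rule finite_subset[OF egyptian_sums_subset[of N 0]]) (simp add: finite_rough_numbers)
  moreover have "(\<Sum>n=1..N. 0 / of_nat n) \<in> egyptian_sums N"
    unfolding egyptian_sums_def by (intro CollectI exI[of _ "\<lambda>_. 0"]) simp
  ultimately show ?thesis by (metis card_gt_0_iff empty_iff)
qed

text \<open>For fixed \<open>k\<close> only \<open>N / k * ln 4\<close> is linear in
  \<open>N\<close>; the bracket collects the lower-order terms from the rough subsets, the small
  primes and the range of numerators.\<close>

lemma ln_card_egyptian_sums_le:
  fixes k N :: nat
  assumes "N \<ge> 2" "k \<ge> 1"
  shows "ln (card (egyptian_sums N)) \<le> N / k * ln 4 +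
    (k * (sqrt N + 2 * ln 4 * N / ln N) * ln 2 + sqrt N * ln N + ln (N + 1))"
proof -
  define y where "y = N div k"
  define L where "L = smooth_multiple y N"
  have L: "L \<ge> 1" using smooth_multiple_pos[of y N] by (simp add: L_def)
  have "card (egyptian_sums N) \<le> 2 ^ card (rough_numbers y N) * (L * N + 1)"
    unfolding L_def by (rule card_egyptian_sums_le)
  \<comment> \<open>Absorbing the 1 by \<open>L \<ge> 1\<close> gives a pure product, whose
    logarithm splits into a sum.\<close>
  also have "\<dots> \<le> 2 ^ card (rough_numbers y N) * (L * (N + 1))"
    using L by (intro mult_left_mono) auto
  finally have "real (card (egyptian_sums N)) \<le> real (2 ^ card (rough_numbers y N) * (L * (N + 1)))"
    by (simp only: of_nat_le_iff)
  then have "ln (card (egyptian_sums N)) \<le> ln (real (2 ^ card (rough_numbers y N) * (L * (N + 1))))"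
    using card_egyptian_sums_pos L
    by (subst ln_le_cancel_iff) (auto intro!: mult_pos_pos add_pos_nonneg)
  also have "\<dots> = card (rough_numbers y N) * ln 2 + ln L + ln (N + 1)"
    using L by (simp add: ln_mult ln_realpow add.commute del: mult_Suc_right)
  also have "\<dots> \<le> k * (sqrt N + 2 * ln 4 * N / ln N) * ln 2 + (N / k * ln 4 + sqrt N * ln N) + ln (N + 1)"
  proof (intro add_mono mult_right_mono order_refl)
    have "real (card (rough_numbers y N)) \<le> k * real (card {p::nat. prime p \<and> p \<le> N})"
      using card_rough_numbers_le[OF assms(2), of N] unfolding y_def
      by (metis of_nat_le_iff of_nat_mult)
    also have "\<dots> \<le> k * (sqrt N + 2 * ln 4 * N / ln N)"
      using card_primes_le[OF assms(1)] by (intro mult_left_mono) auto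
    finally show "real (card (rough_numbers y N)) \<le> k * (sqrt N + 2 * ln 4 * N / ln N)" .
    have "ln L \<le> y * ln 4 + sqrt N * ln N"
      unfolding L_def using assms by (intro ln_smooth_multiple_le) auto
    also have "real y * ln 4 \<le> N / k * ln 4"
      unfolding y_def by (intro mult_right_mono of_nat_div_le_of_nat) auto
    finally show "ln L \<le> N / k * ln 4 + sqrt N * ln N" by simp
  qed simp
  finally show ?thesis by simp
qed

theorem theorem1p2:
  shows "egyptian_alpha < ereal 0.421 \<and>
    (\<forall>\<^sub>F N in sequentially. ln (real (card (egyptian_sums N))) < 0.421 * real N)"
proof -
  \<comment> \<open>These are the lower-order terms for \<open>k = 8\<close>. The main term is at
    most \<open>N / 4\<close> because \<open>ln 4 \<le> 2\<close>, so the total is at most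
    \<open>0.35 * N\<close>, within the target \<open>0.4 * N\<close>.\<close>
  have "\<forall>\<^sub>F N in sequentially.
    8 * (sqrt (real N) + 2 * ln 4 * real N / ln (real N)) * ln 2 + sqrt (real N) * ln (real N) + ln (real N + 1) \<le> 0.1 * real N"
    by real_asymp
  with eventually_ge_at_top[of 2]
  have *: "\<forall>\<^sub>F N in sequentially. ln (real (card (egyptian_sums N))) \<le> 0.4 * real N \<and> N \<ge> 2"
  proof eventually_elim
    case (elim N)
    have "ln (4::real) = 2 * ln 2"
      using ln_realpow[of 2 2] by simp
    then have "ln (4::real) \<le> 2" using ln_2_less_1 by simp
    then have "N / 8 * ln 4 \<le> N / 8 * (2::real)"
      by (intro mult_left_mono) auto
    moreover have "ln (card (egyptian_sums N)) \<le> N / 8 * ln 4 +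
      (8 * (sqrt N + 2 * ln 4 * N / ln N) * ln 2 + sqrt N * ln N + ln (real N + 1))"
      using elim ln_card_egyptian_sums_le[of N 8] by (simp add: add.commute)
    ultimately show ?case
      using elim by linarith
  qed
  \<comment> \<open>An eventual bound passes to the limit superior only non-strictly; the gap
    between 0.4 and 0.421 restores strictness.\<close>
  have "egyptian_alpha \<le> ereal 0.4"
    unfolding egyptian_alpha_def
    by (rule Limsup_bounded, rule eventually_mono[OF *]) (auto simp: field_simps)
  moreover have "\<forall>\<^sub>F N in sequentially. ln (real (card (egyptian_sums N))) < 0.421 * real N"
    using * by eventually_elim simp
  ultimately show ?thesis
    by (auto elim: le_less_trans)
qed

end
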